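(* For $n\ge 1$ let the random variable $X_n$ denote the number of summands in the Factorial Number System Representation of an integer picked uniformly at random from $[0,(n+1)!)$. Let $X_n'$ be the normalization of $X_n$ having mean $0$ and variance $1$, i.e. $X_n'=(X_n-\mathbb{E}(X_n))/\sqrt{\operatorname{Var}(X_n)}$. Then $X_n'$ converges in distribution to the standard normal distribution as $n\to\infty$.
   Context: $\mathbb{N}_0=\{0,1,2,\dots\}$. Given $f:\mathbb{N}_0\to\mathbb{N}_0$ and a sequence $\{a_n\}_{n=0}^\infty$, an $f$-decomposition of $x$ using $\{a_n\}$ is a finite sum $x=\sum_{i} a_{n_i}$ of terms with pairwise distinct indices $n_i\ge 0$, such that for every $a_{n_i}$ in the sum, the previous $f(n_i)$ terms $a_{n_i-f(n_i)},\dots,a_{n_i-1}$ (those with index $\ge 0$) are not in the sum. The $f$-sequence is the unique increasing sequence of positive integers such that every positive integer has a unique $f$-decomposition; explicitly $a_n=1$ for $n<1$ and $a_n=a_{n-1}+a_{n-1-f(n-1)}$ for $n\ge 1$. The Factorial Number System Representation of $x$ is its unique $f$-decomposition using the $f$-sequence for the function $f$ whose values are $\{f(n)\}_{n\ge 0}=0;\,0,1;\,0,1,2;\,0,1,2,3;\dots$, where the values are grouped in consecutive "bins", the $i$-th bin ($i\ge1$) having $i$ entries $0,1,\dots,i-1$. The corresponding $f$-sequence is $1;\,2,4;\,6,12,18;\,24,48,72,96;\dots$, the $i$-th bin being $i!,2\cdot i!,\dots,i\cdot i!$. The integer $0$ is represented by the empty sum (zero summands). *)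

theory Defs
  imports "HOL-Probability.Probability"
begin

section \<open>Decompositions and their sequences\<close>

text \<open>
  A decomposition is represented by its finite set \<open>S\<close> of (distinct) indices. The truncated
  subtraction on \<^typ>\<open>nat\<close> in \<open>{i - f i..<i}\<close> discards exactly the negative indices.
\<close>

definition f_legal :: "(nat \<Rightarrow> nat) \<Rightarrow> nat set \<Rightarrow> bool" where
  "f_legal f S \<longleftrightarrow> finite S \<and> (\<forall>i\<in>S. {i - f i..<i} \<inter> S = {})"

definition f_decomposition :: "(nat \<Rightarrow> nat) \<Rightarrow> (nat \<Rightarrow> nat) \<Rightarrow> nat \<Rightarrow> nat set \<Rightarrow> bool" where
  "f_decomposition f a x S \<longleftrightarrow> f_legal f S \<and> x = (\<Sum>i\<in>S. a i)"

definition is_f_sequence :: "(nat \<Rightarrow> nat) \<Rightarrow> (nat \<Rightarrow> nat) \<Rightarrow> bool" where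
  "is_f_sequence f a \<longleftrightarrow>
     strict_mono a \<and> (\<forall>n. a n > 0) \<and> (\<forall>x>0. \<exists>!S. f_decomposition f a x S)"

definition f_sequence :: "(nat \<Rightarrow> nat) \<Rightarrow> nat \<Rightarrow> nat" where
  "f_sequence f = (THE a. is_f_sequence f a)"

section \<open>The factorial number system\<close>

text \<open>
  The values are read off the list \<open>[0] @ [0, 1] @ [0, 1, 2] @ \<dots>\<close> of the first \<open>n + 1\<close> bins,
  which has more than \<open>n\<close> entries; see \<open>factorial_f_bin\<close> below.
\<close>

definition factorial_f :: "nat \<Rightarrow> nat" where
  "factorial_f n = concat (map (\<lambda>i. [0..<i]) [1..<n + 2]) ! n"

definition factorial_representation :: "nat \<Rightarrow> nat set" where
  "factorial_representation x =
     (THE S. f_decomposition factorial_f (f_sequence factorial_f) x S)"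

definition num_summands :: "nat \<Rightarrow> real" where
  "num_summands x = real (card (factorial_representation x))"

definition uniform_below_fact :: "nat \<Rightarrow> nat pmf" where
  "uniform_below_fact n = pmf_of_set {0..<fact (n + 1)}"

text \<open>
  \<open>X\<^sub>n\<close> is \<^const>\<open>num_summands\<close> on the probability space \<^term>\<open>uniform_below_fact n\<close>. For
  \<open>n = 0\<close> the variance vanishes and the value below is the junk value \<open>0\<close>; this does not affect
  limits as \<open>n\<close> tends to infinity.
\<close>

definition normalized_summands :: "nat \<Rightarrow> nat \<Rightarrow> real" where
  "normalized_summands n x =
     (num_summands x - measure_pmf.expectation (uniform_below_fact n) num_summands) /
     sqrt (measure_pmf.variance (uniform_below_fact n) num_summands)"

section \<open>Well-definedness\<close>

fun f_rec :: "(nat \<Rightarrow> nat) \<Rightarrow> nat \<Rightarrow> nat" where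
  "f_rec f 0 = 1"
| "f_rec f (Suc n) = f_rec f n + f_rec f (n - f n)"

lemma f_rec_pos: "f_rec f n > 0"
  by (induction n) auto

lemma strict_mono_f_rec: "strict_mono (f_rec f)"
  by (intro strict_monoI_Suc) (simp add: f_rec_pos)

lemma f_legal_Suc:
  "{S. S \<subseteq> {..<Suc n} \<and> f_legal f S} =
     {S. S \<subseteq> {..<n} \<and> f_legal f S} \<union> insert n ` {S. S \<subseteq> {..<n - f n} \<and> f_legal f S}"
  (is "?L = ?A \<union> insert n ` ?B")
proof (intro equalityI subsetI)
  fix S assume S: "S \<in> ?L"
  show "S \<in> ?A \<union> insert n ` ?B"
  proof (cases "n \<in> S")
    case False
    with S have "S \<in> ?A" by (auto simp: less_Suc_eq)
    then show ?thesis by blast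
  next
    case True
    have "i < n - f n" if "i \<in> S - {n}" for i
    proof -
      have "i < n" using that S by (auto simp: less_Suc_eq)
      moreover have "i \<notin> {n - f n..<n}" using True S that unfolding f_legal_def by blast
      ultimately show ?thesis by auto
    qed
    moreover have "f_legal f (S - {n})"
      using S by (fastforce simp: f_legal_def)
    ultimately have "S - {n} \<in> ?B" by auto
    moreover have "S = insert n (S - {n})" using True by auto
    ultimately show ?thesis by blast
  qed
next
  fix S assume "S \<in> ?A \<union> insert n ` ?B"
  then show "S \<in> ?L"
  proof
    assume "S \<in> insert n ` ?B"
    then obtain T where T: "S = insert n T" "T \<subseteq> {..<n - f n}" "f_legal f T" by auto
    have "n \<notin> {i - f i..<i}" if "i \<in> T" for i using T(2) that by auto
    then have "f_legal f S" using T by (fastforce simp: f_legal_def)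
    moreover have "S \<subseteq> {..<Suc n}" using T by fastforce
    ultimately show ?thesis by simp
  qed auto
qed

lemma bij_betw_f_rec:
  "bij_betw (sum (f_rec f)) {S. S \<subseteq> {..<n} \<and> f_legal f S} {..<f_rec f n}"
proof (induction n rule: less_induct)
  case (less n)
  show ?case
  proof (cases n)
    case 0
    then show ?thesis by (auto simp: bij_betw_def inj_on_def f_legal_def image_def)
  next
    case (Suc m)
    define A where "A = {S. S \<subseteq> {..<m} \<and> f_legal f S}"
    define B where "B = {S. S \<subseteq> {..<m - f m} \<and> f_legal f S}"
    let ?s = "sum (f_rec f)"
    have A: "bij_betw ?s A {..<f_rec f m}" and B: "bij_betw ?s B {..<f_rec f (m - f m)}"
      unfolding A_def B_def using less.IH Suc by simp_all
    have m: "finite T" "m \<notin> T" if "T \<in> B" for T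
      using that by (auto simp: B_def f_legal_def)
    have inj: "inj_on (insert m) B"
      using m by (auto intro!: inj_onI simp: insert_ident)
    have shift: "bij_betw ((+) (f_rec f m)) {..<f_rec f (m - f m)}
        {f_rec f m..<f_rec f m + f_rec f (m - f m)}"
      unfolding bij_betw_def lessThan_atLeast0 by (simp add: add.commute)
    have "bij_betw (?s \<circ> insert m) B {f_rec f m..<f_rec f (Suc m)}"
      using bij_betw_trans[OF B shift] m by (subst bij_betw_cong[of _ _ "(+) (f_rec f m) \<circ> ?s"]) auto
    then have "bij_betw ?s (insert m ` B) {f_rec f m..<f_rec f (Suc m)}"
      using inj by (auto simp: bij_betw_def image_comp inj_on_def)
    with A have "bij_betw ?s (A \<union> insert m ` B) ({..<f_rec f m} \<union> {f_rec f m..<f_rec f (Suc m)})"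
      by (rule bij_betw_combine) auto
    moreover have "{..<f_rec f m} \<union> {f_rec f m..<f_rec f (Suc m)} = {..<f_rec f (Suc m)}"
      by auto
    ultimately show ?thesis unfolding Suc f_legal_Suc A_def B_def by simp
  qed
qed

lemma ex1_f_decomposition_f_rec: "\<exists>!S. f_decomposition f (f_rec f) x S"
proof -
  have x: "x < f_rec f (Suc x)"
    using strict_mono_imp_increasing[OF strict_mono_f_rec, of "Suc x" f] by simp
  show ?thesis
  proof (rule ex_ex1I)
    have "x \<in> sum (f_rec f) ` {S. S \<subseteq> {..<Suc x} \<and> f_legal f S}"
      using bij_betw_f_rec[of f "Suc x"] x unfolding bij_betw_def by simp
    then show "\<exists>S. f_decomposition f (f_rec f) x S"
      unfolding f_decomposition_def by auto
  next
    fix S T assume S: "f_decomposition f (f_rec f) x S" and T: "f_decomposition f (f_rec f) x T"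
    then have "finite (S \<union> T)" by (auto simp: f_decomposition_def f_legal_def)
    then obtain n where "S \<union> T \<subseteq> {..<n}"
      using finite_nat_iff_bounded by blast
    with S T show "S = T"
      by (intro inj_onD[OF bij_betw_imp_inj_on[OF bij_betw_f_rec[of f n]]])
        (auto simp: f_decomposition_def)
  qed
qed

lemma is_f_sequence_unique:
  assumes a: "is_f_sequence f a" and b: "is_f_sequence f b"
  shows "a = b"
proof -
  have le: "c n \<le> d n"
    if c: "is_f_sequence f c" and d: "is_f_sequence f d" and eq: "\<And>k. k < n \<Longrightarrow> c k = d k"
    for c d n
  proof -
    have "d n > 0" using d by (auto simp: is_f_sequence_def)
    with c obtain S where S: "f_legal f S" "d n = sum c S"
      unfolding is_f_sequence_def f_decomposition_def by meson
    have fin: "finite S" using S(1) by (simp add: f_legal_def)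
    have "\<exists>i\<in>S. n \<le> i"
    proof (rule ccontr)
      assume "\<not> (\<exists>i\<in>S. n \<le> i)"
      then have lt: "\<And>i. i \<in> S \<Longrightarrow> i < n" by auto
      then have "f_decomposition f d (d n) S"
        using S eq by (auto simp: f_decomposition_def intro!: sum.cong)
      moreover have "f_decomposition f d (d n) {n}"
        by (simp add: f_decomposition_def f_legal_def)
      ultimately have "S = {n}"
        using d \<open>d n > 0\<close> unfolding is_f_sequence_def by blast
      with lt show False by blast
    qed
    then obtain i where i: "i \<in> S" "n \<le> i" by blast
    have "c n \<le> c i"
      using c i by (simp add: is_f_sequence_def strict_mono_less_eq)
    also have "c i \<le> sum c S"
      using fin i by (intro member_le_sum) auto
    finally show ?thesis using S by simp
  qed
  have "a n = b n" for n
  proof (induction n rule: less_induct)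
    case (less n)
    then show ?case using le[OF a b, of n] le[OF b a, of n] by force
  qed
  then show ?thesis by blast
qed

lemma is_f_sequence_f_rec: "is_f_sequence f (f_rec f)"
  by (simp add: is_f_sequence_def strict_mono_f_rec f_rec_pos ex1_f_decomposition_f_rec)

lemma f_sequence_eq_f_rec: "f_sequence f = f_rec f"
  unfolding f_sequence_def
  by (rule the_equality) (auto intro: is_f_sequence_f_rec is_f_sequence_unique)

lemma is_f_sequence_f_sequence: "is_f_sequence f (f_sequence f)"
  by (simp add: f_sequence_eq_f_rec is_f_sequence_f_rec)

lemma f_sequence_rec:
  "f_sequence f 0 = 1"
  "f_sequence f (Suc n) = f_sequence f n + f_sequence f (n - f n)"
  by (simp_all add: f_sequence_eq_f_rec)

lemma factorial_representation:
  "f_decomposition factorial_f (f_sequence factorial_f) x (factorial_representation x)"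
  unfolding factorial_representation_def f_sequence_eq_f_rec
  by (rule theI') (rule ex1_f_decomposition_f_rec)

lemma length_bins: "length (concat (map (\<lambda>i. [0..<i]) [1..<Suc k])) = k * (k + 1) div 2"
  by (induction k) auto

lemma factorial_f_bin:
  assumes "j < i"
  shows "factorial_f (i * (i - 1) div 2 + j) = j"
proof -
  let ?c = "\<lambda>xs. concat (map (\<lambda>i. [0..<i]) xs)"
  define n where "n = i * (i - 1) div 2 + j"
  obtain k where k: "i = Suc k" using assms by (cases i) auto
  have tri: "i * (i - 1) div 2 = k * (k + 1) div 2" by (simp add: k mult.commute)
  have "k \<le> k * (k + 1) div 2" by (induction k) auto
  then have le: "i \<le> n + 1" using k by (simp add: n_def tri)
  have "[1..<n + 2] = [1..<i] @ i # [Suc i..<n + 2]"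
    using le k upt_add_eq_append[of 1 i "n + 2 - i"] by (simp add: upt_conv_Cons)
  then have "?c [1..<n + 2] = ?c [1..<i] @ [0..<i] @ ?c [Suc i..<n + 2]" by simp
  moreover have "length (?c [1..<i]) = i * (i - 1) div 2"
    using length_bins[of k] unfolding k tri[unfolded k] by simp
  ultimately have "factorial_f n = j"
    using assms by (simp add: factorial_f_def nth_append n_def)
  then show ?thesis by (simp add: n_def)
qed

end

theory Submission
  imports Defs
begin

text \<open>
  In the representation of \<open>x < (n + 1)!\<close> every bin contributes at most one summand, and bin \<open>i\<close>
  offers the \<open>i + 1\<close> equally likely choices of no summand or of one of its \<open>i\<close> entries. So the
  number of summands is distributed as a sum of independent Bernoulli variables with parameters
  \<open>i / (i + 1)\<close> for \<open>1 \<le> i \<le> n\<close>. Its variance \<open>V\<close> is the sum of \<open>i / (i + 1)\<^sup>2\<close>, which grows like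
  the harmonic series, and a triangular array of bounded independent variables whose variance
  tends to infinity satisfies the central limit theorem.

  The independence is used only through the recursion
  \<open>E[g(X\<^sub>n\<^sub>+\<^sub>1)] = (1 - p) E[g(X\<^sub>n)] + p E[g(X\<^sub>n + 1)]\<close> with \<open>p = (n + 1) / (n + 2)\<close>, valid for
  every function \<open>g\<close> (lemma \<open>expectation_summands_Suc\<close>). It comes from splitting the legal index
  sets according to the choice in the last bin. Applied to \<open>x + c\<close>, \<open>(x - c)\<^sup>2\<close> and
  \<open>exp (\<i> s (x - c))\<close>, by induction on \<open>n\<close> for all \<open>c\<close> simultaneously, it yields the mean, the
  variance, and the characteristic function as a product over the bins.

  For the limit, each factor of the centred characteristic function is compared with
  \<open>exp (- s\<^sup>2 v / 2)\<close>, where \<open>v\<close> is the variance of that bin. The errors add up to at most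
  \<open>(\<bar>s\<bar>\<^sup>3 + s\<^sup>4) V\<close> (lemma \<open>prod_centred_bernoulli_char_approx\<close>). At \<open>s = t / sqrt V\<close> the
  product of the Gaussian factors is exactly \<open>exp (- t\<^sup>2 / 2)\<close> and the error tends to \<open>0\<close>, so the
  continuity theorem of Levy applies.
\<close>

section \<open>Counting legal index sets by cardinality\<close>

definition legal_below :: "(nat \<Rightarrow> nat) \<Rightarrow> nat \<Rightarrow> nat set set" where
  "legal_below f m = {S. S \<subseteq> {..<m} \<and> f_legal f S}"

definition bins_size :: "nat \<Rightarrow> nat" where
  "bins_size n = n * (n + 1) div 2"

lemma bins_size_simps [simp]: "bins_size 0 = 0" "bins_size (Suc n) = bins_size n + Suc n"
  by (simp_all add: bins_size_def)

lemma factorial_f_bins_size: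
  assumes "j \<le> n"
  shows "factorial_f (bins_size n + j) = j"
  using factorial_f_bin[of j "Suc n"] assms by (simp add: bins_size_def mult.commute)

text \<open>
  A legal set below \<open>m + 1\<close> either avoids \<open>m\<close>, or consists of \<open>m\<close> and a legal set below
  \<open>m - f m\<close>, because \<open>m\<close> excludes its \<open>f m\<close> predecessors.
\<close>

lemma sum_legal_below_Suc:
  fixes g :: "nat \<Rightarrow> 'a::comm_monoid_add"
  shows "(\<Sum>S\<in>legal_below f (Suc m). g (card S)) =
    (\<Sum>S\<in>legal_below f m. g (card S)) + (\<Sum>S\<in>legal_below f (m - f m). g (Suc (card S)))"
proof -
  let ?B = "legal_below f (m - f m)"
  have fin: "finite (legal_below f k)" for k
    by (rule finite_subset[of _ "Pow {..<k}"]) (auto simp: legal_below_def)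
  have B: "finite T" "m \<notin> T" if "T \<in> ?B" for T
    using that by (auto simp: legal_below_def f_legal_def)
  have inj: "inj_on (insert m) ?B"
    using B by (auto intro!: inj_onI simp: insert_ident)
  have "(\<Sum>S\<in>legal_below f (Suc m). g (card S)) =
      (\<Sum>S\<in>legal_below f m \<union> insert m ` ?B. g (card S))"
    unfolding legal_below_def f_legal_Suc ..
  also have "\<dots> = (\<Sum>S\<in>legal_below f m. g (card S)) + (\<Sum>S\<in>insert m ` ?B. g (card S))"
    using fin by (intro sum.union_disjoint) (auto simp: legal_below_def)
  also have "(\<Sum>S\<in>insert m ` ?B. g (card S)) = (\<Sum>S\<in>?B. g (Suc (card S)))"
    using B inj by (subst sum.reindex) (auto intro!: sum.cong)
  finally show ?thesis .
qed

text \<open>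
  The first \<open>n\<close> bins comprise \<open>bins_size n\<close> indices. An entry of the next bin excludes all earlier
  entries of that bin and nothing before it, so each of its \<open>j\<close> first entries extends every legal
  set of the first \<open>n\<close> bins by one element.
\<close>

lemma sum_legal_below_within_bin:
  fixes g :: "nat \<Rightarrow> 'a::real_vector"
  assumes "j \<le> Suc n"
  shows "(\<Sum>S\<in>legal_below factorial_f (bins_size n + j). g (card S)) =
    (\<Sum>S\<in>legal_below factorial_f (bins_size n). g (card S)) +
    real j *\<^sub>R (\<Sum>S\<in>legal_below factorial_f (bins_size n). g (Suc (card S)))"
  using assms
proof (induction j)
  case (Suc j)
  then show ?case
    using factorial_f_bins_size[of j n] sum_legal_below_Suc[where g = g and m = "bins_size n + j"]
    by (simp add: scaleR_add_left)
qed simp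

lemma f_rec_within_bin:
  "j \<le> Suc n \<Longrightarrow> f_rec factorial_f (bins_size n + j) = (1 + j) * f_rec factorial_f (bins_size n)"
proof (induction j)
  case (Suc j)
  then show ?case using factorial_f_bins_size[of j n] by simp
qed simp

text \<open>
  The legal sets of the first \<open>n\<close> bins represent exactly the integers in \<open>[0, (n + 1)!)\<close>, which
  turns the uniform distribution on integers into the uniform distribution on legal sets.
\<close>

lemma f_rec_bins_size: "f_rec factorial_f (bins_size n) = fact (n + 1)"
proof (induction n)
  case (Suc n)
  then show ?case using f_rec_within_bin[of "Suc n" n] by simp
qed simp

section \<open>Mean, variance and characteristic function\<close>

lemma expectation_summands:
  fixes g :: "real \<Rightarrow> 'a::{banach, second_countable_topology}"
  shows "measure_pmf.expectation (uniform_below_fact n) (\<lambda>x. g (num_summands x)) =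
    (1 / fact (n + 1)) *\<^sub>R (\<Sum>S\<in>legal_below factorial_f (bins_size n). g (real (card S)))"
proof -
  let ?N = "fact (n + 1) :: nat" and ?s = "sum (f_rec factorial_f)"
  have rep: "num_summands (?s S) = real (card S)" if "S \<in> legal_below factorial_f (bins_size n)" for S
  proof -
    have S: "f_decomposition factorial_f (f_rec factorial_f) (?s S) S"
      using that by (simp add: legal_below_def f_decomposition_def)
    have "factorial_representation (?s S) = S"
      unfolding factorial_representation_def f_sequence_eq_f_rec
      using ex1_f_decomposition_f_rec S by (rule the1_equality)
    then show ?thesis by (simp add: num_summands_def)
  qed
  have bij: "bij_betw ?s (legal_below factorial_f (bins_size n)) {0..<?N}"
    using bij_betw_f_rec[of factorial_f "bins_size n"]
    by (simp add: legal_below_def f_rec_bins_size atLeast0LessThan del: fact_Suc)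
  have "measure_pmf.expectation (uniform_below_fact n) (\<lambda>x. g (num_summands x)) =
      (\<Sum>x\<in>{0..<?N}. pmf (uniform_below_fact n) x *\<^sub>R g (num_summands x))"
    by (intro integral_measure_pmf) (auto simp: uniform_below_fact_def simp del: fact_Suc)
  also have "\<dots> = (\<Sum>x\<in>{0..<?N}. (1 / ?N) *\<^sub>R g (num_summands x))"
    by (intro sum.cong) (auto simp: uniform_below_fact_def simp del: fact_Suc)
  also have "\<dots> = (1 / ?N) *\<^sub>R (\<Sum>x\<in>{0..<?N}. g (num_summands x))"
    by (simp only: scaleR_right.sum)
  also have "(\<Sum>x\<in>{0..<?N}. g (num_summands x)) =
      (\<Sum>S\<in>legal_below factorial_f (bins_size n). g (num_summands (?s S)))"
    by (rule sum.reindex_bij_betw[OF bij, symmetric])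
  also have "\<dots> = (\<Sum>S\<in>legal_below factorial_f (bins_size n). g (real (card S)))"
    using rep by (intro sum.cong) auto
  finally show ?thesis by (simp only: of_nat_fact)
qed

text \<open>
  The first bin has index \<open>0\<close> here: \<open>digit_prob i\<close> belongs to the bin with \<open>i + 1\<close> entries, hence
  with \<open>i + 2\<close> choices, of which all but one add a summand.
\<close>

definition digit_prob :: "nat \<Rightarrow> real" where
  "digit_prob i = real (i + 1) / real (i + 2)"

definition digit_var :: "nat \<Rightarrow> real" where
  "digit_var i = digit_prob i * (1 - digit_prob i)"

lemma expectation_summands_0:
  fixes g :: "real \<Rightarrow> 'a::{banach, second_countable_topology}"
  shows "measure_pmf.expectation (uniform_below_fact 0) (\<lambda>x. g (num_summands x)) = g 0"
proof -
  have "legal_below factorial_f 0 = {{}}" by (auto simp: legal_below_def f_legal_def)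
  then show ?thesis by (simp add: expectation_summands)
qed

text \<open>
  The recursion that stands in for independence: the last bin has \<open>n + 2\<close> equally likely
  choices, one of which is empty, whatever the choices in the other bins.
\<close>

lemma expectation_summands_Suc:
  fixes g :: "real \<Rightarrow> 'a::{banach, second_countable_topology}"
  shows "measure_pmf.expectation (uniform_below_fact (Suc n)) (\<lambda>x. g (num_summands x)) =
    (1 - digit_prob n) *\<^sub>R
      measure_pmf.expectation (uniform_below_fact n) (\<lambda>x. g (num_summands x)) +
    digit_prob n *\<^sub>R
      measure_pmf.expectation (uniform_below_fact n) (\<lambda>x. g (num_summands x + 1))"
proof -
  let ?A = "\<Sum>S\<in>legal_below factorial_f (bins_size n). g (real (card S))"
  let ?B = "\<Sum>S\<in>legal_below factorial_f (bins_size n). g (real (card S) + 1)"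
  have sum: "(\<Sum>S\<in>legal_below factorial_f (bins_size (Suc n)). g (real (card S))) = ?A + real (Suc n) *\<^sub>R ?B"
    using sum_legal_below_within_bin[of "Suc n" n "\<lambda>k. g (real k)"] by (simp add: add.commute)
  have fact: "(fact (Suc n + 1) :: real) = real (n + 2) * fact (n + 1)" by simp
  have "1 - digit_prob n = 1 / real (n + 2)" by (simp add: digit_prob_def field_simps)
  then have coeffs: "1 / fact (Suc n + 1) = (1 - digit_prob n) * (1 / fact (n + 1))"
    "1 / fact (Suc n + 1) * real (Suc n) = digit_prob n * (1 / fact (n + 1))"
    unfolding fact by (simp_all add: digit_prob_def del: fact_Suc)
  have "(1 / fact (Suc n + 1)) *\<^sub>R (?A + real (Suc n) *\<^sub>R ?B) =
      (1 / fact (Suc n + 1)) *\<^sub>R ?A + (1 / fact (Suc n + 1) * real (Suc n)) *\<^sub>R ?B"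
    by (simp only: scaleR_add_right scaleR_scaleR)
  also have "\<dots> = (1 - digit_prob n) *\<^sub>R (1 / fact (n + 1)) *\<^sub>R ?A +
      digit_prob n *\<^sub>R (1 / fact (n + 1)) *\<^sub>R ?B"
    unfolding coeffs(2) unfolding coeffs(1) scaleR_scaleR ..
  finally show ?thesis
    unfolding expectation_summands[of "Suc n" g] expectation_summands[of n g]
      expectation_summands[of n "\<lambda>x. g (x + 1)"] sum .
qed

lemma expectation_num_summands_add:
  "measure_pmf.expectation (uniform_below_fact n) (\<lambda>x. num_summands x + c) =
    (\<Sum>i<n. digit_prob i) + c"
proof (induction n arbitrary: c)
  case 0
  show ?case using expectation_summands_0[of "\<lambda>x. x + c"] by simp
next
  case (Suc n)
  show ?case
    using expectation_summands_Suc[of n "\<lambda>x. x + c"] Suc[of c] Suc[of "1 + c"]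
    by (simp add: algebra_simps)
qed

text \<open>
  A new bin shifts the centre by \<open>0\<close> or \<open>1\<close>, so the induction needs every \<open>c\<close> at once. With the
  mean for \<open>c\<close> the last term vanishes and the variance remains.
\<close>

lemma expectation_num_summands_diff_square:
  "measure_pmf.expectation (uniform_below_fact n) (\<lambda>x. (num_summands x - c)\<^sup>2) =
    (\<Sum>i<n. digit_var i) + ((\<Sum>i<n. digit_prob i) - c)\<^sup>2"
proof (induction n arbitrary: c)
  case 0
  show ?case using expectation_summands_0[of "\<lambda>x. (x - c)\<^sup>2"] by simp
next
  case (Suc n)
  let ?p = "digit_prob n" and ?m = "\<Sum>i<n. digit_prob i" and ?v = "\<Sum>i<n. digit_var i"
  have shift: "(\<lambda>x. (num_summands x + 1 - c)\<^sup>2) = (\<lambda>x. (num_summands x - (c - 1))\<^sup>2)"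
    by (simp add: algebra_simps)
  have "measure_pmf.expectation (uniform_below_fact (Suc n)) (\<lambda>x. (num_summands x - c)\<^sup>2) =
      (1 - ?p) * (?v + (?m - c)\<^sup>2) + ?p * (?v + (?m - (c - 1))\<^sup>2)"
    unfolding expectation_summands_Suc[of n "\<lambda>x. (x - c)\<^sup>2"] shift Suc real_scaleR_def ..
  also have "\<dots> = (?v + digit_var n) + ((?m + ?p) - c)\<^sup>2"
    unfolding digit_var_def[of n] by (simp add: algebra_simps power2_eq_square)
  finally show ?case by simp
qed

definition centred_bernoulli_char :: "real \<Rightarrow> real \<Rightarrow> complex" where
  "centred_bernoulli_char p s = (1 - p) *\<^sub>R iexp (- s * p) + p *\<^sub>R iexp (s * (1 - p))"

lemma expectation_iexp_num_summands:
  "measure_pmf.expectation (uniform_below_fact n) (\<lambda>x. iexp (s * (num_summands x - c))) =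
    iexp (s * ((\<Sum>i<n. digit_prob i) - c)) * (\<Prod>i<n. centred_bernoulli_char (digit_prob i) s)"
proof (induction n arbitrary: c)
  case 0
  show ?case using expectation_summands_0[of "\<lambda>x. iexp (s * (x - c))"] by simp
next
  case (Suc n)
  let ?\<mu> = "\<Sum>i<n. digit_prob i" and ?p = "digit_prob n"
  have "(\<lambda>x. iexp (s * (num_summands x - (c - 1)))) = (\<lambda>x. iexp (s * (num_summands x + 1 - c)))"
    by (simp add: algebra_simps)
  moreover have "iexp (s * (?\<mu> - c)) = iexp (s * (?\<mu> + ?p - c)) * iexp (- s * ?p)"
    "iexp (s * (?\<mu> - (c - 1))) = iexp (s * (?\<mu> + ?p - c)) * iexp (s * (1 - ?p))"
    by (simp_all add: exp_add[symmetric] algebra_simps)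
  ultimately show ?case
    using expectation_summands_Suc[of n "\<lambda>x. iexp (s * (x - c))"] Suc[of c] Suc[of "c - 1"]
    by (simp add: centred_bernoulli_char_def scaleR_conv_of_real algebra_simps
        del: of_real_mult of_real_diff of_real_add of_real_minus)
qed

section \<open>Convergence to the normal distribution\<close>

lemma norm_centred_bernoulli_char_le_1:
  assumes "0 \<le> p" "p \<le> 1"
  shows "cmod (centred_bernoulli_char p s) \<le> 1"
proof -
  have "cmod (centred_bernoulli_char p s) \<le>
      cmod ((1 - p) *\<^sub>R iexp (- s * p)) + cmod (p *\<^sub>R iexp (s * (1 - p)))"
    unfolding centred_bernoulli_char_def by (rule norm_triangle_ineq)
  also have "\<dots> = 1" using assms by (simp del: of_real_mult of_real_diff of_real_minus)
  finally show ?thesis .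
qed

text \<open>
  Second-order Taylor expansion: the first moment is zero and the variance is \<open>p (1 - p)\<close>. The
  third absolute moment is \<open>p (1 - p) (p\<^sup>2 + (1 - p)\<^sup>2)\<close>, so that the error is again proportional
  to the variance; this is what makes the sum of the errors controllable.
\<close>

lemma centred_bernoulli_char_approx:
  assumes p: "0 \<le> p" "p \<le> 1"
  shows "cmod (centred_bernoulli_char p s - of_real (1 - s\<^sup>2 * (p * (1 - p)) / 2)) \<le>
    \<bar>s\<bar> ^ 3 * (p * (1 - p))"
proof -
  \<comment> \<open>\<open>R\<close> is the Taylor remainder of \<open>iexp\<close>\<close>
  define R where "R x = iexp x - (1 + \<i> * of_real x - of_real (x\<^sup>2) / 2)" for x :: real
  have R: "cmod (R x) \<le> \<bar>x\<bar> ^ 3" for x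
  proof -
    have "cmod (R x) \<le> \<bar>x\<bar> ^ 3 / 6"
      using iexp_approx1[of x 2]
      by (simp add: R_def numeral_2_eq_2 numeral_3_eq_3 fact_numeral power_mult_distrib
          algebra_simps)
    also have "\<dots> \<le> \<bar>x\<bar> ^ 3" by simp
    finally show ?thesis .
  qed
  have "centred_bernoulli_char p s - of_real (1 - s\<^sup>2 * (p * (1 - p)) / 2) =
      (1 - p) *\<^sub>R R (- s * p) + p *\<^sub>R R (s * (1 - p))"
    unfolding centred_bernoulli_char_def R_def scaleR_conv_of_real
    by (simp add: field_simps power2_eq_square)
  also have "cmod \<dots> \<le> cmod ((1 - p) *\<^sub>R R (- s * p)) + cmod (p *\<^sub>R R (s * (1 - p)))"
    by (rule norm_triangle_ineq)
  also have "\<dots> = (1 - p) * cmod (R (- s * p)) + p * cmod (R (s * (1 - p)))"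
    using p by simp
  also have "\<dots> \<le> (1 - p) * \<bar>- s * p\<bar> ^ 3 + p * \<bar>s * (1 - p)\<bar> ^ 3"
    using p by (intro add_mono mult_left_mono R) auto
  also have "\<dots> = \<bar>s\<bar> ^ 3 * (p * (1 - p)) * (p\<^sup>2 + (1 - p)\<^sup>2)"
  proof -
    have "\<bar>- s * p\<bar> = \<bar>s\<bar> * p" "\<bar>s * (1 - p)\<bar> = \<bar>s\<bar> * (1 - p)"
      using p by (simp_all add: abs_mult)
    then show ?thesis by (simp only: power2_eq_square power3_eq_cube) (simp add: algebra_simps)
  qed
  also have "\<dots> \<le> \<bar>s\<bar> ^ 3 * (p * (1 - p)) * 1"
  proof (rule mult_left_mono)
    have "p\<^sup>2 + (1 - p)\<^sup>2 = 1 - 2 * (p * (1 - p))" by (simp add: power2_eq_square algebra_simps)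
    then show "p\<^sup>2 + (1 - p)\<^sup>2 \<le> 1" using p by simp
  qed (use p in simp)
  finally show ?thesis by simp
qed

lemma exp_minus_quadratic_approx:
  fixes x :: real
  assumes "0 \<le> x"
  shows "\<bar>exp (- x) - (1 - x)\<bar> \<le> x\<^sup>2 / 2"
proof -
  have pos: "1 - x + x\<^sup>2 / 2 \<ge> 0"
    using sum_squares_ge_zero[of "1 - x" 1] by (simp add: power2_eq_square algebra_simps)
  \<comment> \<open>the product below is \<open>1 + x\<^sup>4 / 4\<close>, which bounds \<open>exp (- x)\<close> through its reciprocal\<close>
  have "1 \<le> (1 + x + x\<^sup>2 / 2) * (1 - x + x\<^sup>2 / 2)"
    using zero_le_power[OF assms, of 4] by (simp add: power2_eq_square power4_eq_xxxx algebra_simps)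
  also have "\<dots> \<le> exp x * (1 - x + x\<^sup>2 / 2)"
    using exp_lower_Taylor_quadratic[OF assms] pos by (rule mult_right_mono)
  finally have "exp (- x) \<le> 1 - x + x\<^sup>2 / 2"
    by (simp add: exp_minus field_simps)
  moreover have "1 - x \<le> exp (- x)" using exp_ge_add_one_self[of "- x"] by simp
  ultimately show ?thesis by simp
qed

text \<open>
  All factors lie in the unit disc, so the error of a product is at most the sum of the errors of
  its factors. Passing from \<open>1 - s\<^sup>2 v / 2\<close> to \<open>exp (- s\<^sup>2 v / 2)\<close> costs \<open>s\<^sup>4 v\<^sup>2 / 8\<close> per factor,
  again at most a multiple of \<open>v\<close> since \<open>v \<le> 1\<close>; the product of the exponentials is exactly
  Gaussian.
\<close>

lemma prod_centred_bernoulli_char_approx: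
  fixes p :: "'i \<Rightarrow> real"
  assumes p: "\<And>i. i \<in> I \<Longrightarrow> 0 \<le> p i \<and> p i \<le> 1"
  defines "V \<equiv> \<Sum>i\<in>I. p i * (1 - p i)"
  shows "cmod ((\<Prod>i\<in>I. centred_bernoulli_char (p i) s) - of_real (exp (- (s\<^sup>2 * V / 2)))) \<le>
    (\<bar>s\<bar> ^ 3 + s ^ 4) * V"
proof (cases "finite I")
  case fin: True
  define v where "v i = p i * (1 - p i)" for i
  have v: "0 \<le> v i" "v i \<le> 1" if "i \<in> I" for i
    using p[OF that] mult_mono[of "p i" 1 "1 - p i" 1] by (simp_all add: v_def)
  let ?e = "\<lambda>i. complex_of_real (exp (- (s\<^sup>2 * v i / 2)))"
  have each: "cmod (centred_bernoulli_char (p i) s - ?e i) \<le> (\<bar>s\<bar> ^ 3 + s ^ 4) * v i"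
    if i: "i \<in> I" for i
  proof -
    let ?l = "1 - s\<^sup>2 * v i / 2"
    have "cmod (centred_bernoulli_char (p i) s - ?e i) \<le>
        cmod (centred_bernoulli_char (p i) s - of_real ?l) + cmod (?e i - of_real ?l)"
      using norm_triangle_ineq4[of "centred_bernoulli_char (p i) s - of_real ?l" "?e i - of_real ?l"]
      by simp
    also have "cmod (?e i - of_real ?l) = \<bar>exp (- (s\<^sup>2 * v i / 2)) - ?l\<bar>"
      by (simp only: of_real_diff[symmetric] norm_of_real)
    also have "\<dots> \<le> (s\<^sup>2 * v i / 2)\<^sup>2 / 2"
      using v[OF i] by (intro exp_minus_quadratic_approx) simp
    also have "\<dots> = s ^ 4 * (v i * v i) / 8"
      by (simp add: power2_eq_square power4_eq_xxxx)
    also have "\<dots> \<le> s ^ 4 * v i"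
    proof -
      have "s ^ 4 * (v i * v i) \<le> s ^ 4 * (v i * 1)"
        using v[OF i] by (intro mult_left_mono) auto
      moreover have "0 \<le> s ^ 4 * v i" using v[OF i] by simp
      ultimately show ?thesis by simp
    qed
    also have "cmod (centred_bernoulli_char (p i) s - of_real ?l) \<le> \<bar>s\<bar> ^ 3 * v i"
      unfolding v_def using p[OF i] by (intro centred_bernoulli_char_approx) auto
    finally show ?thesis by (simp add: algebra_simps)
  qed
  have "of_real (exp (- (s\<^sup>2 * V / 2))) = (\<Prod>i\<in>I. ?e i)"
    using fin by (simp add: V_def v_def[symmetric] sum_distrib_left sum_divide_distrib
        sum_negf[symmetric] exp_sum flip: of_real_prod)
  then have "cmod ((\<Prod>i\<in>I. centred_bernoulli_char (p i) s) - of_real (exp (- (s\<^sup>2 * V / 2)))) \<le>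
      (\<Sum>i\<in>I. cmod (centred_bernoulli_char (p i) s - ?e i))"
    using p v by (auto intro!: norm_prod_diff norm_centred_bernoulli_char_le_1)
  also have "\<dots> \<le> (\<Sum>i\<in>I. (\<bar>s\<bar> ^ 3 + s ^ 4) * v i)"
    by (intro sum_mono each)
  finally show ?thesis by (simp add: V_def v_def sum_distrib_left)
qed (simp add: V_def)

text \<open>
  Each term \<open>(i + 1) / (i + 2)\<^sup>2\<close> is at least a quarter of \<open>1 / (i + 1)\<close>, so the sum dominates a
  multiple of the harmonic series.
\<close>

lemma sum_digit_var_at_top: "filterlim (\<lambda>n. \<Sum>i<n. digit_var i) at_top sequentially"
proof (rule filterlim_at_top_mono)
  show "filterlim (\<lambda>n. 1 / 4 * harm n :: real) at_top sequentially"
    by (rule filterlim_tendsto_pos_mult_at_top[OF tendsto_const _ harm_at_top]) simp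
  have "1 / 4 * inverse (real (Suc i)) \<le> digit_var i" for i
    by (simp add: digit_var_def digit_prob_def divide_simps) (simp add: algebra_simps)
  then have "1 / 4 * harm n \<le> (\<Sum>i<n. digit_var i)" for n
    unfolding harm_altdef sum_distrib_left by (intro sum_mono)
  then show "\<forall>\<^sub>F n in sequentially. 1 / 4 * harm n \<le> (\<Sum>i<n. digit_var i)"
    by simp
qed

theorem theorem1p7:
  shows "weak_conv_m
    (\<lambda>n. distr (measure_pmf (uniform_below_fact n)) borel (normalized_summands n))
    std_normal_distribution"
proof (rule levy_continuity)
  fix t :: real
  \<comment> \<open>by Levy it suffices that the characteristic functions converge at every \<open>t\<close>\<close>
  define \<mu> where "\<mu> n = (\<Sum>i<n. digit_prob i)" for n
  define V where "V n = (\<Sum>i<n. digit_var i)" for n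
  let ?\<phi> = "\<lambda>n. char (distr (measure_pmf (uniform_below_fact n)) borel (normalized_summands n)) t"
  have mean: "measure_pmf.expectation (uniform_below_fact n) num_summands = \<mu> n" for n
    using expectation_num_summands_add[of n 0] by (simp add: \<mu>_def)
  have normalized: "normalized_summands n = (\<lambda>x. (num_summands x - \<mu> n) / sqrt (V n))" for n
    using expectation_num_summands_diff_square[of n "\<mu> n"]
    by (simp add: normalized_summands_def mean \<mu>_def V_def fun_eq_iff)
  define s where "s n = t / sqrt (V n)" for n
  have char_eq: "?\<phi> n = (\<Prod>i<n. centred_bernoulli_char (digit_prob i) (s n))" for n
    using expectation_iexp_num_summands[of n "s n" "\<mu> n"]
    by (simp add: char_def integral_distr normalized \<mu>_def s_def)
  have V_lim: "filterlim V at_top sequentially"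
    using sum_digit_var_at_top by (simp add: V_def[abs_def])
  have s_lim: "s \<longlonglongrightarrow> 0"
    unfolding s_def[abs_def]
    by (intro real_tendsto_divide_at_top[OF tendsto_const] filterlim_compose[OF sqrt_at_top V_lim])
  \<comment> \<open>\<open>V 0 = 0\<close>, where normalization is degenerate, so the bound is only claimed once \<open>V n > 0\<close>\<close>
  have bound: "\<forall>\<^sub>F n in sequentially. cmod (?\<phi> n - of_real (exp (- (t\<^sup>2 / 2)))) \<le>
      (\<bar>s n\<bar> + (s n)\<^sup>2) * t\<^sup>2"
    using filterlim_at_top_dense[THEN iffD1, OF V_lim, rule_format, of 0]
  proof eventually_elim
    case (elim n)
    have s2: "(s n)\<^sup>2 * V n = t\<^sup>2" using elim by (simp add: s_def power_divide)
    have "\<bar>s n\<bar> ^ 3 + s n ^ 4 = (\<bar>s n\<bar> + (s n)\<^sup>2) * (s n)\<^sup>2"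
      by (simp add: power2_eq_square power3_eq_cube power4_eq_xxxx algebra_simps)
    then have "(\<bar>s n\<bar> ^ 3 + s n ^ 4) * V n = (\<bar>s n\<bar> + (s n)\<^sup>2) * t\<^sup>2"
      by (simp only: mult.assoc s2)
    moreover have "cmod (?\<phi> n - of_real (exp (- ((s n)\<^sup>2 * V n / 2)))) \<le>
        (\<bar>s n\<bar> ^ 3 + s n ^ 4) * V n"
      unfolding char_eq V_def digit_var_def
      by (intro prod_centred_bernoulli_char_approx) (simp add: digit_prob_def)
    ultimately show ?case unfolding s2 by simp
  qed
  have "(\<lambda>n. (\<bar>s n\<bar> + (s n)\<^sup>2) * t\<^sup>2) \<longlonglongrightarrow> (\<bar>0\<bar> + 0\<^sup>2) * t\<^sup>2"
    by (intro tendsto_intros s_lim)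
  then have "(\<lambda>n. ?\<phi> n - of_real (exp (- (t\<^sup>2 / 2)))) \<longlonglongrightarrow> 0"
    by (intro Lim_null_comparison[OF bound]) simp
  then show "?\<phi> \<longlonglongrightarrow> char std_normal_distribution t"
    by (simp add: char_std_normal_distribution LIM_zero_iff)
qed (auto intro!: real_dist_normal_dist prob_space.real_distribution_distr prob_space_measure_pmf)

end
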